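(* Let $D\subseteq\{0,1\}^n$ be a domain. $D$ admits a binary aggregator $(f_1,\ldots,f_n)$ which is not a projection aggregator if and only if there exists a renamable partially Horn formula $\phi$ whose set of models equals $D$.
   Context: Standing assumption: domains $D\subseteq\{0,1\}^n$ are non-degenerate, i.e. the projection of $D$ onto each coordinate is $\{0,1\}$. A binary aggregator for $D$ is an $n$-tuple $(f_1,\ldots,f_n)$ of unanimous functions $f_j:\{0,1\}^2\to\{0,1\}$ such that for all $x,y\in D$, $(f_1(x_1,y_1),\ldots,f_n(x_n,y_n))\in D$; it is a projection aggregator if each $f_j$ is a projection ${\rm pr}^2_1$ or ${\rm pr}^2_2$ (the only other unanimous binary functions being $\wedge$ and $\vee$). A Horn clause has at most one positive literal. Renaming a set $W$ of variables means replacing every occurrence of $x$ by $\neg x$ and of $\neg x$ by $x$, for $x\in W$. A CNF formula over $V$ is partially Horn if there is a non-empty $V_0\subseteq V$ such that (i) every clause containing only variables from $V_0$ is Horn and (ii) variables of $V_0$ appear only negatively (if at all) in clauses that also contain variables not in $V_0$; it is renamable partially Horn if some variables can be renamed so that it becomes partially Horn. *)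

theory Defs
  imports "HOL-Analysis.Finite_Cartesian_Product"
begin

text \<open>
  The \<open>n\<close> coordinates (issues, propositional variables) are the elements of a finite index type
  \<open>'n\<close>, with \<open>n = CARD('n)\<close>; \<open>{0,1}\<close> is \<^typ>\<open>bool\<close>, so a domain is a set of vectors in
  \<^typ>\<open>bool ^ 'n\<close>.
\<close>

definition non_degenerate :: "(bool ^ 'n) set \<Rightarrow> bool" where
  "non_degenerate D \<longleftrightarrow> (\<forall>j. (\<lambda>x. x $ j) ` D = {False, True})"

definition unanimous :: "(bool \<Rightarrow> bool \<Rightarrow> bool) \<Rightarrow> bool" where
  "unanimous g \<longleftrightarrow> (\<forall>b. g b b = b)"

definition pr1 :: "bool \<Rightarrow> bool \<Rightarrow> bool" where
  "pr1 a b = a"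

definition pr2 :: "bool \<Rightarrow> bool \<Rightarrow> bool" where
  "pr2 a b = b"

definition binary_aggregator ::
    "(bool ^ 'n) set \<Rightarrow> ('n \<Rightarrow> bool \<Rightarrow> bool \<Rightarrow> bool) \<Rightarrow> bool" where
  "binary_aggregator D f \<longleftrightarrow>
     (\<forall>j. unanimous (f j)) \<and>
     (\<forall>x\<in>D. \<forall>y\<in>D. (\<chi> j. f j (x $ j) (y $ j)) \<in> D)"

text \<open>Different coordinates may use different projections.\<close>

definition projection_aggregator ::
    "(bool ^ 'n) set \<Rightarrow> ('n \<Rightarrow> bool \<Rightarrow> bool \<Rightarrow> bool) \<Rightarrow> bool" where
  "projection_aggregator D f \<longleftrightarrow>
     binary_aggregator D f \<and> (\<forall>j. f j = pr1 \<or> f j = pr2)"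

text \<open>
  A clause is the disjunction of a set of literals, and a CNF formula the conjunction of a set
  of clauses, over all variables of the finite type \<open>'n\<close>. Both kinds of set are therefore
  automatically finite. A variable need not occur in the formula.
\<close>

datatype 'n literal = Pos 'n | Neg 'n

primrec var :: "'n literal \<Rightarrow> 'n" where
  "var (Pos v) = v"
| "var (Neg v) = v"

type_synonym 'n clause = "'n literal set"
type_synonym 'n cnf = "'n clause set"

definition vars :: "'n clause \<Rightarrow> 'n set" where
  "vars C = var ` C"

primrec holds :: "bool ^ 'n \<Rightarrow> 'n literal \<Rightarrow> bool" where
  "holds x (Pos v) \<longleftrightarrow> x $ v"
| "holds x (Neg v) \<longleftrightarrow> \<not> x $ v"

definition models :: "'n cnf \<Rightarrow> (bool ^ 'n) set" where
  "models \<phi> = {x. \<forall>C\<in>\<phi>. \<exists>l\<in>C. holds x l}"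

definition horn :: "('n::finite) clause \<Rightarrow> bool" where
  "horn C \<longleftrightarrow> card {v. Pos v \<in> C} \<le> 1"

primrec rename_literal :: "'n set \<Rightarrow> 'n literal \<Rightarrow> 'n literal" where
  "rename_literal W (Pos v) = (if v \<in> W then Neg v else Pos v)"
| "rename_literal W (Neg v) = (if v \<in> W then Pos v else Neg v)"

definition rename :: "'n set \<Rightarrow> 'n cnf \<Rightarrow> 'n cnf" where
  "rename W \<phi> = (\<lambda>C. rename_literal W ` C) ` \<phi>"

definition partially_horn :: "('n::finite) cnf \<Rightarrow> bool" where
  "partially_horn \<phi> \<longleftrightarrow>
     (\<exists>V0. V0 \<noteq> {} \<and>
        (\<forall>C\<in>\<phi>. vars C \<subseteq> V0 \<longrightarrow> horn C) \<and>
        (\<forall>C\<in>\<phi>. \<not> vars C \<subseteq> V0 \<longrightarrow> (\<forall>v\<in>V0. Pos v \<notin> C)))"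

definition renamable_partially_horn :: "('n::finite) cnf \<Rightarrow> bool" where
  "renamable_partially_horn \<phi> \<longleftrightarrow> (\<exists>W. partially_horn (rename W \<phi>))"

end

theory Submission
  imports Defs
begin

text \<open>
  Complementing the coordinates in \<open>W\<close> of a domain corresponds to renaming \<open>W\<close> in a formula and
  exchanges \<open>\<and>\<close> with \<open>\<or>\<close> on \<open>W\<close> in an aggregator. Up to such a flip, a non-projection
  aggregator \<open>f\<close> consists of \<open>\<and>\<close> on a nonempty set \<open>V0\<close> and of projections elsewhere, and
  \<open>f (f x y) x\<close> is \<open>\<and>\<close> on \<open>V0\<close> and \<open>pr1\<close> off \<open>V0\<close>. Closure of a domain under this one operation
  characterises the partially Horn formulas with witness \<open>V0\<close>: Horn clauses inside \<open>V0\<close> are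
  preserved by \<open>\<and>\<close>, and the other clauses because the operation only decreases \<open>x\<close> on \<open>V0\<close>;
  conversely a closed domain is defined by all the admissible clauses that it satisfies.
\<close>

section \<open>Partial meets and admissible clauses\<close>

definition partial_meet :: "'n set \<Rightarrow> bool ^ 'n \<Rightarrow> bool ^ 'n \<Rightarrow> bool ^ 'n" where
  "partial_meet V x y = (\<chi> j. if j \<in> V then x $ j \<and> y $ j else x $ j)"

lemma partial_meet_nth [simp]:
  "partial_meet V x y $ j \<longleftrightarrow> (if j \<in> V then x $ j \<and> y $ j else x $ j)"
  by (simp add: partial_meet_def)

definition meet_closed :: "'n set \<Rightarrow> (bool ^ 'n) set \<Rightarrow> bool" where
  "meet_closed V D \<longleftrightarrow> (\<forall>x\<in>D. \<forall>y\<in>D. partial_meet V x y \<in> D)"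

definition satisfies :: "bool ^ 'n \<Rightarrow> 'n clause \<Rightarrow> bool" where
  "satisfies x C \<longleftrightarrow> (\<exists>l\<in>C. holds x l)"

lemma models_iff: "x \<in> models \<phi> \<longleftrightarrow> (\<forall>C\<in>\<phi>. satisfies x C)"
  by (simp add: models_def satisfies_def)

definition admissible :: "('n::finite) set \<Rightarrow> 'n clause \<Rightarrow> bool" where
  "admissible V C \<longleftrightarrow>
     (vars C \<subseteq> V \<longrightarrow> horn C) \<and> (\<not> vars C \<subseteq> V \<longrightarrow> (\<forall>v\<in>V. Pos v \<notin> C))"

lemma partially_horn_iff:
  "partially_horn \<phi> \<longleftrightarrow> (\<exists>V. V \<noteq> {} \<and> (\<forall>C\<in>\<phi>. admissible V C))"
  by (simp add: partially_horn_def admissible_def ball_conj_distrib)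

lemma hornD:
  assumes "horn C" "Pos u \<in> C" "Pos v \<in> C"
  shows "u = v"
  using assms card_le_Suc0_iff_eq[of "{v. Pos v \<in> C}"] by (simp add: horn_def)

lemma satisfies_partial_meet:
  assumes C: "admissible V C" and x: "satisfies x C" and y: "satisfies y C"
  shows "satisfies (partial_meet V x y) C"
proof -
  obtain l where l: "l \<in> C" "holds x l"
    using x by (auto simp: satisfies_def)
  obtain m where m: "m \<in> C" "holds y m"
    using y by (auto simp: satisfies_def)
  show ?thesis
  proof (cases "vars C \<subseteq> V")
    case True
    then have horn: "horn C"
      using C by (simp add: admissible_def)
    have "var l \<in> V" "var m \<in> V"
      using True l m by (auto simp: vars_def)
    \<comment> \<open>A negative literal on \<open>V\<close> survives the meet once it holds in
      \<open>x\<close> or in \<open>y\<close>. If \<open>l\<close> and \<open>m\<close> are both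
      positive, Horn-ness makes them the same literal, which then holds in both.\<close>
    then have "holds (partial_meet V x y) l \<or> holds (partial_meet V x y) m"
      using l m hornD[OF horn] by (cases l; cases m) auto
    then show ?thesis
      using l m by (auto simp: satisfies_def)
  next
    case False
    then have "\<forall>v\<in>V. Pos v \<notin> C"
      using C by (simp add: admissible_def)
    then have "holds (partial_meet V x y) l"
      using l by (cases l) auto
    then show ?thesis
      using l by (auto simp: satisfies_def)
  qed
qed

lemma meet_closed_models:
  assumes "\<forall>C\<in>\<phi>. admissible V C"
  shows "meet_closed V (models \<phi>)"
  using assms by (auto simp: meet_closed_def models_iff intro!: satisfies_partial_meet)

lemma admissible_no_Pos:
  assumes "\<forall>v\<in>V. Pos v \<notin> C"
  shows "admissible V C"
proof -
  have "horn C" if "vars C \<subseteq> V"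
  proof -
    have "{v. Pos v \<in> C} = {}"
      using assms that by (force simp: vars_def)
    then show ?thesis
      by (simp add: horn_def)
  qed
  with assms show ?thesis
    by (simp add: admissible_def)
qed

lemma admissible_horn:
  assumes "vars C \<subseteq> V" "{v. Pos v \<in> C} \<subseteq> {j}"
  shows "admissible V C"
  using assms card_mono[of "{j}" "{v. Pos v \<in> C}"] by (simp add: admissible_def horn_def)

section \<open>Defining a closed domain by admissible clauses\<close>

lemma meet_closed_agrees_on:
  fixes x :: "bool ^ 'n::finite"
  assumes D: "meet_closed V D"
    and bound: "\<exists>y\<in>D. \<forall>v\<in>V. x $ v \<longrightarrow> y $ v"
    and sep: "\<And>j. j \<in> V \<Longrightarrow> \<not> x $ j \<Longrightarrow> \<exists>y\<in>D. (\<forall>v\<in>V. x $ v \<longrightarrow> y $ v) \<and> \<not> y $ j"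
  shows "\<exists>y\<in>D. \<forall>v\<in>V. y $ v = x $ v"
proof -
  \<comment> \<open>Start from the bound and meet with one separator per coordinate of
    \<open>T\<close>: each meet stays above \<open>x\<close> on \<open>V\<close> and makes one more
    coordinate false.\<close>
  have "\<exists>y\<in>D. (\<forall>v\<in>V. x $ v \<longrightarrow> y $ v) \<and> (\<forall>v\<in>T. \<not> y $ v)"
    if "T \<subseteq> {v\<in>V. \<not> x $ v}" for T
    using finite[of T] that
  proof (induction T rule: finite_induct)
    case empty
    then show ?case
      using bound by simp
  next
    case (insert j T)
    then obtain y where y: "y \<in> D" "\<forall>v\<in>V. x $ v \<longrightarrow> y $ v" "\<forall>v\<in>T. \<not> y $ v"
      by auto
    obtain z where z: "z \<in> D" "\<forall>v\<in>V. x $ v \<longrightarrow> z $ v" "\<not> z $ j"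
      using sep[of j] insert.prems by auto
    have "partial_meet V y z \<in> D"
      using D y z by (simp add: meet_closed_def)
    then show ?case
      using y z insert.prems by (intro bexI[of _ "partial_meet V y z"]) auto
  qed
  from this[OF order_refl] show ?thesis
    by blast
qed

text \<open>Every admissible clause that a model \<open>x\<close> falsifies is also falsified
  somewhere in \<open>D\<close>. Well-chosen clauses thus yield elements of \<open>D\<close> close
  enough to \<open>x\<close> for a partial meet to produce \<open>x\<close> itself.\<close>

lemma models_admissible:
  fixes D :: "(bool ^ 'n::finite) set"
  assumes D: "meet_closed V D"
  shows "models {C. admissible V C \<and> (\<forall>y\<in>D. satisfies y C)} = D" (is "models ?\<phi> = D")
proof
  show "D \<subseteq> models ?\<phi>"
    by (auto simp: models_iff)
  show "models ?\<phi> \<subseteq> D"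
  proof
    fix x
    assume x: "x \<in> models ?\<phi>"
    have counterexample: "\<exists>y\<in>D. \<not> satisfies y C" if "admissible V C" "\<not> satisfies x C" for C
      using x that by (auto simp: models_iff)
    \<comment> \<open>A point falsifies \<open>N\<close> exactly when it lies above \<open>x\<close>
      on \<open>V\<close>; adding \<open>Pos j\<close> also forces it to be false at
      \<open>j\<close>.\<close>
    define N where "N = Neg ` {v\<in>V. x $ v}"
    have "\<exists>y\<in>D. \<not> satisfies y N"
      by (rule counterexample) (auto simp: N_def satisfies_def intro!: admissible_no_Pos)
    then have bound: "\<exists>y\<in>D. \<forall>v\<in>V. x $ v \<longrightarrow> y $ v"
      by (auto simp: N_def satisfies_def)
    have sep: "\<exists>y\<in>D. (\<forall>v\<in>V. x $ v \<longrightarrow> y $ v) \<and> \<not> y $ j" if j: "j \<in> V" "\<not> x $ j" for j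
    proof -
      have "\<exists>y\<in>D. \<not> satisfies y (insert (Pos j) N)"
        using j by (intro counterexample admissible_horn[where j = j])
          (auto simp: N_def satisfies_def vars_def)
      then show ?thesis
        by (auto simp: N_def satisfies_def)
    qed
    obtain y where y: "y \<in> D" "\<forall>v\<in>V. y $ v = x $ v"
      using meet_closed_agrees_on[OF D bound sep] by blast
    \<comment> \<open>Falsifying \<open>F\<close> means agreeing with \<open>x\<close> off
      \<open>V\<close>.\<close>
    define F where "F = {l. var l \<notin> V \<and> \<not> holds x l}"
    have "\<exists>z\<in>D. \<not> satisfies z (N \<union> F)"
      by (rule counterexample) (auto simp: N_def F_def satisfies_def intro!: admissible_no_Pos)
    then obtain z where z: "z \<in> D" "\<And>l. l \<in> N \<union> F \<Longrightarrow> \<not> holds z l"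
      by (auto simp: satisfies_def)
    have z_V: "z $ v" if "v \<in> V" "x $ v" for v
      using z(2)[of "Neg v"] that by (simp add: N_def)
    have z_out: "z $ v = x $ v" if "v \<notin> V" for v
      using z(2)[of "Pos v"] z(2)[of "Neg v"] that by (auto simp: F_def)
    \<comment> \<open>\<open>z\<close> comes first because it supplies the coordinates off
      \<open>V\<close>; on \<open>V\<close> it lies above \<open>x\<close>, so the meet there is
      decided by \<open>y\<close>.\<close>
    have "partial_meet V z y = x"
      using y z_V z_out by (auto simp: vec_eq_iff)
    then show "x \<in> D"
      using D y z by (auto simp: meet_closed_def)
  qed
qed

theorem partially_horn_models_iff:
  fixes D :: "(bool ^ 'n::finite) set"
  shows "(\<exists>\<phi>. partially_horn \<phi> \<and> models \<phi> = D) \<longleftrightarrow> (\<exists>V. V \<noteq> {} \<and> meet_closed V D)"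
proof
  assume "\<exists>\<phi>. partially_horn \<phi> \<and> models \<phi> = D"
  then show "\<exists>V. V \<noteq> {} \<and> meet_closed V D"
    unfolding partially_horn_iff using meet_closed_models by blast
next
  assume "\<exists>V. V \<noteq> {} \<and> meet_closed V D"
  then obtain V where V: "V \<noteq> {}" "meet_closed V D"
    by blast
  have "partially_horn {C. admissible V C \<and> (\<forall>y\<in>D. satisfies y C)}"
    using V(1) by (auto simp: partially_horn_iff)
  with models_admissible[OF V(2)] show "\<exists>\<phi>. partially_horn \<phi> \<and> models \<phi> = D"
    by blast
qed

section \<open>Renaming as flipping coordinates\<close>

definition flip :: "'n set \<Rightarrow> bool ^ 'n \<Rightarrow> bool ^ 'n" where
  "flip W x = (\<chi> j. x $ j \<noteq> (j \<in> W))"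

lemma flip_nth [simp]: "flip W x $ j \<longleftrightarrow> x $ j \<noteq> (j \<in> W)"
  by (simp add: flip_def)

lemma flip_flip [simp]: "flip W (flip W x) = x"
  by (auto simp: vec_eq_iff)

lemma flip_vimage_vimage [simp]: "flip W -` flip W -` D = D"
  by auto

lemma rename_literal_rename_literal [simp]: "rename_literal W (rename_literal W l) = l"
  by (cases l) auto

lemma rename_rename [simp]: "rename W (rename W \<phi>) = \<phi>"
  by (simp add: rename_def image_image)

lemma holds_rename_literal [simp]: "holds x (rename_literal W l) \<longleftrightarrow> holds (flip W x) l"
  by (cases l) auto

lemma models_rename: "models (rename W \<phi>) = flip W -` models \<phi>"
  by (auto simp: models_def rename_def)

lemma renamable_partially_horn_models_iff:
  fixes D :: "(bool ^ 'n::finite) set"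
  shows "(\<exists>\<phi>. renamable_partially_horn \<phi> \<and> models \<phi> = D) \<longleftrightarrow>
         (\<exists>W V. V \<noteq> {} \<and> meet_closed V (flip W -` D))"
proof -
  \<comment> \<open>For fixed \<open>W\<close>, renaming is an involution on formulas, so it can be
    moved from the formula to the domain.\<close>
  have "(\<exists>\<phi>. partially_horn (rename W \<phi>) \<and> models \<phi> = D) \<longleftrightarrow>
        (\<exists>\<phi>. partially_horn \<phi> \<and> models \<phi> = flip W -` D)" for W
  proof
    assume "\<exists>\<phi>. partially_horn (rename W \<phi>) \<and> models \<phi> = D"
    then show "\<exists>\<phi>. partially_horn \<phi> \<and> models \<phi> = flip W -` D"
      using models_rename by blast
  next
    assume "\<exists>\<phi>. partially_horn \<phi> \<and> models \<phi> = flip W -` D"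
    then obtain \<phi> where "partially_horn \<phi>" "models \<phi> = flip W -` D"
      by blast
    then show "\<exists>\<phi>. partially_horn (rename W \<phi>) \<and> models \<phi> = D"
      by (intro exI[of _ "rename W \<phi>"]) (simp add: models_rename)
  qed
  from this[unfolded partially_horn_models_iff] show ?thesis
    unfolding renamable_partially_horn_def by blast
qed

section \<open>Aggregators and closure under partial meets\<close>

lemma unanimous_cases:
  assumes "unanimous g"
  obtains "g = pr1" | "g = pr2" | "g = (\<and>)" | "g = (\<or>)"
proof -
  have "g = pr1 \<or> g = pr2 \<or> g = (\<and>) \<or> g = (\<or>)"
    \<comment> \<open>Unanimity leaves only the values at \<open>True False\<close> and
      \<open>False True\<close> free.\<close>
    using assms unfolding fun_eq_iff all_bool_eq unanimous_def pr1_def pr2_def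
    by argo
  then show ?thesis
    using that by blast
qed

lemma connectives_distinct:
  "(\<and>) \<noteq> pr1" "(\<and>) \<noteq> pr2" "(\<or>) \<noteq> pr1" "(\<or>) \<noteq> pr2" "(\<and>) \<noteq> (\<or>)"
  by (auto simp: fun_eq_iff pr1_def pr2_def)

lemma aggregator_imp_meet_closed:
  assumes f: "binary_aggregator D f" and nonproj: "\<not> projection_aggregator D f"
  shows "\<exists>W V. V \<noteq> {} \<and> meet_closed V (flip W -` D)"
proof (intro exI conjI)
  define V where "V = {j. f j \<noteq> pr1 \<and> f j \<noteq> pr2}"
  define W where "W = {j. f j = (\<or>)}"
  show "V \<noteq> {}"
    using f nonproj by (auto simp: V_def projection_aggregator_def)
  define F where "F x y = (\<chi> j. f j (x $ j) (y $ j))" for x y :: "bool ^ 'a"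
  have F: "F x y \<in> D" if "x \<in> D" "y \<in> D" for x y
    using f that by (simp add: binary_aggregator_def F_def)
  have una: "unanimous (f j)" for j
    using f by (simp add: binary_aggregator_def)
  \<comment> \<open>The nesting turns \<open>pr2\<close> into \<open>pr1\<close>, since the second
    application swaps back to the first argument; \<open>pr1\<close>, \<open>(\<and>)\<close> and
    \<open>(\<or>)\<close> are unchanged by it. By De Morgan, flipping \<open>W\<close> turns
    \<open>(\<or>)\<close> into \<open>(\<and>)\<close>.\<close>
  have *: "F (F (flip W x) (flip W y)) (flip W x) = flip W (partial_meet V x y)" for x y
  proof (rule vec_eq_iff[THEN iffD2, OF allI])
    fix j
    from una[of j] connectives_distinct
    show "F (F (flip W x) (flip W y)) (flip W x) $ j = flip W (partial_meet V x y) $ j"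
      by (cases rule: unanimous_cases)
        (auto simp: F_def V_def W_def pr1_def pr2_def)
  qed
  show "meet_closed V (flip W -` D)"
    using F by (simp add: meet_closed_def flip: *)
qed

lemma meet_closed_imp_aggregator:
  assumes V: "V \<noteq> {}" and D: "meet_closed V (flip W -` D)"
  shows "\<exists>f. binary_aggregator D f \<and> \<not> projection_aggregator D f"
proof (intro exI conjI)
  \<comment> \<open>This is \<open>partial_meet V\<close> conjugated by \<open>flip W\<close>.
    Points of \<open>W\<close> outside \<open>V\<close> do no harm, since \<open>pr1\<close>
    commutes with negation.\<close>
  define f where "f j = (if j \<in> V then if j \<in> W then (\<or>) else (\<and>) else pr1)" for j
  have "(\<chi> j. f j (x $ j) (y $ j)) = flip W (partial_meet V (flip W x) (flip W y))" for x y
    by (auto simp: vec_eq_iff f_def pr1_def)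
  moreover have "flip W (partial_meet V (flip W x) (flip W y)) \<in> D" if "x \<in> D" "y \<in> D" for x y
    using D that by (simp add: meet_closed_def)
  moreover have "unanimous (f j)" for j
    by (simp add: f_def unanimous_def pr1_def)
  ultimately show "binary_aggregator D f"
    by (simp add: binary_aggregator_def)
  obtain j where "j \<in> V"
    using V by blast
  then have "f j \<noteq> pr1 \<and> f j \<noteq> pr2"
    using connectives_distinct by (simp add: f_def)
  then show "\<not> projection_aggregator D f"
    by (auto simp: projection_aggregator_def)
qed

theorem theorem4p3:
  fixes D :: "(bool ^ 'n::finite) set"
  assumes "non_degenerate D"
  shows "(\<exists>f. binary_aggregator D f \<and> \<not> projection_aggregator D f) \<longleftrightarrow>
         (\<exists>\<phi> :: 'n cnf. renamable_partially_horn \<phi> \<and> models \<phi> = D)"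
  unfolding renamable_partially_horn_models_iff
  by (intro iffI; elim exE conjE)
    (simp_all add: aggregator_imp_meet_closed meet_closed_imp_aggregator)

end
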